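(* For all $d,d'>0$, $T_{\rm rel}(\lfloor d/q\rfloor)\asymp T_{\rm rel}(\lfloor d'/q\rfloor)$ as $q\downarrow0$. In particular, for all $d'>d>0$, $$\lim_{q\downarrow0}\Big(\frac{T_{\rm rel}(\lfloor d'/q\rfloor)}{T_{\rm rel}(\lfloor d/q\rfloor)}\Big)^{1/\log(1/q)}=1.$$
   Context: Fix $q\in(0,1/2)$, $p=1-q$. $T_{\rm rel}(L)$ denotes the relaxation time (inverse spectral gap) of the East process on $\Lambda=\{1,\dots,L\}$: the Markov chain on $\{0,1\}^\Lambda$ with generator $\mathcal L f(\sigma)=\sum_{x\in\Lambda}c_x(\sigma)[\pi_x(f)-f](\sigma)$, $c_1\equiv1$, $c_x(\sigma)=1-\sigma_{x-1}$ for $x\ge2$, where $\pi_x(f)$ averages $f$ over $\sigma_x\sim$ Bernoulli$(p)$; the gap is $\inf_f \sum_x\pi(c_x\mathrm{Var}_x f)/\mathrm{Var}_\pi(f)$ with $\pi$ the product Bernoulli$(p)$ measure. For positive $f,h$, $f\asymp h$ means $0<\liminf_{q\downarrow0}f/h\le\limsup_{q\downarrow0}f/h<\infty$. *)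

theory Defs
  imports "HOL-Analysis.Analysis" "HOL-Library.Landau_Symbols"
begin

text \<open>East process on {1..L}. A configuration is sigma :: nat => bool, with
 sigma x = True meaning sigma_x = 1, supported in {1..L}. Parameter q, p = 1 - q;
 sigma_x ~ Bernoulli(p).\<close>

definition east_confs :: "nat \<Rightarrow> (nat \<Rightarrow> bool) set" where
  "east_confs L = {\<sigma>. \<forall>x. \<sigma> x \<longrightarrow> x \<in> {1..L}}"

definition east_pi :: "real \<Rightarrow> nat \<Rightarrow> (nat \<Rightarrow> bool) \<Rightarrow> real" where
  "east_pi q L \<sigma> = (\<Prod>x\<in>{1..L}. if \<sigma> x then 1 - q else q)"

definition east_mean :: "real \<Rightarrow> nat \<Rightarrow> ((nat \<Rightarrow> bool) \<Rightarrow> real) \<Rightarrow> real" where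
  "east_mean q L f = (\<Sum>\<sigma>\<in>east_confs L. east_pi q L \<sigma> * f \<sigma>)"

definition east_var :: "real \<Rightarrow> nat \<Rightarrow> ((nat \<Rightarrow> bool) \<Rightarrow> real) \<Rightarrow> real" where
  "east_var q L f = east_mean q L (\<lambda>\<sigma>. (f \<sigma>)\<^sup>2) - (east_mean q L f)\<^sup>2"

definition site_mean :: "real \<Rightarrow> nat \<Rightarrow> ((nat \<Rightarrow> bool) \<Rightarrow> real) \<Rightarrow> (nat \<Rightarrow> bool) \<Rightarrow> real" where
  "site_mean q x f \<sigma> = (1 - q) * f (\<sigma>(x := True)) + q * f (\<sigma>(x := False))"

definition site_var :: "real \<Rightarrow> nat \<Rightarrow> ((nat \<Rightarrow> bool) \<Rightarrow> real) \<Rightarrow> (nat \<Rightarrow> bool) \<Rightarrow> real" where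
  "site_var q x f \<sigma> = site_mean q x (\<lambda>\<eta>. (f \<eta>)\<^sup>2) \<sigma> - (site_mean q x f \<sigma>)\<^sup>2"

definition east_c :: "nat \<Rightarrow> (nat \<Rightarrow> bool) \<Rightarrow> real" where
  "east_c x \<sigma> = (if x = 1 then 1 else if \<sigma> (x - 1) then 0 else 1)"

definition east_dirichlet :: "real \<Rightarrow> nat \<Rightarrow> ((nat \<Rightarrow> bool) \<Rightarrow> real) \<Rightarrow> real" where
  "east_dirichlet q L f = (\<Sum>x\<in>{1..L}. east_mean q L (\<lambda>\<sigma>. east_c x \<sigma> * site_var q x f \<sigma>))"

definition east_gap :: "real \<Rightarrow> nat \<Rightarrow> real" where
  "east_gap q L = Inf {east_dirichlet q L f / east_var q L f | f. east_var q L f \<noteq> 0}"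

definition Trel :: "real \<Rightarrow> nat \<Rightarrow> real" where
  "Trel q L = 1 / east_gap q L"

end

theory Submission
  imports Defs
begin

text \<open>
  By definition of the gap, the relaxation time is the least Poincare constant, and it is monotone
  in the length. For the converse bound, cut the interval after site a and call the right part
  good if the last l sites of the left part contain a vacancy, an event of probability
  s = 1 - (1 - q)^l. A two-block variance inequality bounds the variance by 2/s times the mean
  variance of the left block plus the mean variance of the right block on the good event.
  Decomposing the good event by the position of the leftmost such vacancy bounds both terms by
  Dirichlet forms, whence T(L) is at most 4/s times the maximum of T(a) and T(L-a+l-1). With l
  about a/2, the length grows by a factor 4/3 at the cost of the factor 4/s, which stays bounded
  when a is of order 1/q; finitely many such steps, their number depending only on d and d',
  lead from d/q to d'/q.
\<close>

section \<open>Variance inequalities for finite weighted sums\<close>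

lemma weighted_variance_eq:
  fixes w f :: "'a \<Rightarrow> real"
  assumes "sum w I = 1"
  shows "(\<Sum>i\<in>I. w i * (f i)\<^sup>2) - (\<Sum>i\<in>I. w i * f i)\<^sup>2
       = (\<Sum>i\<in>I. w i * (f i - (\<Sum>k\<in>I. w k * f k))\<^sup>2)"
proof -
  define m where "m = (\<Sum>k\<in>I. w k * f k)"
  have "(\<Sum>i\<in>I. w i * (f i - m)\<^sup>2) = (\<Sum>i\<in>I. w i * (f i)\<^sup>2 - 2 * m * (w i * f i) + m\<^sup>2 * w i)"
    by (intro sum.cong refl) (simp add: power2_eq_square algebra_simps)
  also have "\<dots> = (\<Sum>i\<in>I. w i * (f i)\<^sup>2) - 2 * m * m + m\<^sup>2 * sum w I"
    by (simp add: sum.distrib sum_subtractf sum_distrib_left m_def)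
  finally show ?thesis
    unfolding m_def[symmetric] using assms by (simp add: power2_eq_square)
qed

lemma weighted_mean_square_le:
  fixes w f :: "'a \<Rightarrow> real"
  assumes "sum w I = 1" "\<And>i. i \<in> I \<Longrightarrow> 0 \<le> w i"
  shows "(\<Sum>i\<in>I. w i * f i)\<^sup>2 \<le> (\<Sum>i\<in>I. w i * (f i)\<^sup>2)"
proof -
  have "0 \<le> (\<Sum>i\<in>I. w i * (f i - (\<Sum>k\<in>I. w k * f k))\<^sup>2)"
    using assms by (intro sum_nonneg) auto
  then show ?thesis using weighted_variance_eq[OF assms(1), of f] by linarith
qed

lemma weighted_Cauchy_Schwarz:
  fixes w f g :: "'a \<Rightarrow> real"
  assumes "\<And>i. i \<in> I \<Longrightarrow> 0 \<le> w i"
  shows "(\<Sum>i\<in>I. w i * (f i * g i))\<^sup>2 \<le> (\<Sum>i\<in>I. w i * (f i)\<^sup>2) * (\<Sum>i\<in>I. w i * (g i)\<^sup>2)"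
proof -
  have "(\<Sum>i\<in>I. (sqrt (w i) * f i) * (sqrt (w i) * g i))\<^sup>2
      \<le> (\<Sum>i\<in>I. (sqrt (w i) * f i)\<^sup>2) * (\<Sum>i\<in>I. (sqrt (w i) * g i)\<^sup>2)"
    by (rule Cauchy_Schwarz_ineq_sum)
  moreover have "(\<Sum>i\<in>I. (sqrt (w i) * f i) * (sqrt (w i) * g i)) = (\<Sum>i\<in>I. w i * (f i * g i))"
  proof (intro sum.cong refl)
    fix i assume "i \<in> I"
    then have "sqrt (w i) * sqrt (w i) = w i" using assms by simp
    then show "sqrt (w i) * f i * (sqrt (w i) * g i) = w i * (f i * g i)"
      by (metis mult.assoc mult.left_commute)
  qed
  moreover have "(\<Sum>i\<in>I. (sqrt (w i) * h i)\<^sup>2) = (\<Sum>i\<in>I. w i * (h i)\<^sup>2)" for h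
    using assms by (intro sum.cong refl) (simp add: power_mult_distrib)
  ultimately show ?thesis by simp
qed

text \<open>Each \<open>F i\<close> is centred at its own mean over \<open>J\<close>; Jensen's
  inequality in \<open>i\<close> is then applied to the centred squares, pointwise in
  \<open>j\<close>.\<close>

lemma weighted_variance_convex:
  fixes u :: "'a \<Rightarrow> real" and v :: "'b \<Rightarrow> real" and F :: "'a \<Rightarrow> 'b \<Rightarrow> real"
  assumes u: "sum u I = 1" "\<And>i. i \<in> I \<Longrightarrow> 0 \<le> u i"
    and v: "sum v J = 1" "\<And>j. j \<in> J \<Longrightarrow> 0 \<le> v j"
  shows "(\<Sum>j\<in>J. v j * (\<Sum>i\<in>I. u i * F i j)\<^sup>2) - (\<Sum>j\<in>J. v j * (\<Sum>i\<in>I. u i * F i j))\<^sup>2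
       \<le> (\<Sum>i\<in>I. u i * ((\<Sum>j\<in>J. v j * (F i j)\<^sup>2) - (\<Sum>j\<in>J. v j * F i j)\<^sup>2))"
proof -
  define m where "m i = (\<Sum>j\<in>J. v j * F i j)" for i
  have mean: "(\<Sum>j\<in>J. v j * (\<Sum>i\<in>I. u i * F i j)) = (\<Sum>i\<in>I. u i * m i)"
    unfolding m_def sum_distrib_left by (subst sum.swap) (simp add: mult.left_commute)
  have "(\<Sum>j\<in>J. v j * (\<Sum>i\<in>I. u i * F i j)\<^sup>2) - (\<Sum>j\<in>J. v j * (\<Sum>i\<in>I. u i * F i j))\<^sup>2
      = (\<Sum>j\<in>J. v j * ((\<Sum>i\<in>I. u i * F i j) - (\<Sum>i\<in>I. u i * m i))\<^sup>2)"
    using weighted_variance_eq[OF v(1), of "\<lambda>j. \<Sum>i\<in>I. u i * F i j"] unfolding mean .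
  also have "\<dots> = (\<Sum>j\<in>J. v j * (\<Sum>i\<in>I. u i * (F i j - m i))\<^sup>2)"
    by (simp add: sum_subtractf right_diff_distrib)
  also have "\<dots> \<le> (\<Sum>j\<in>J. v j * (\<Sum>i\<in>I. u i * (F i j - m i)\<^sup>2))"
    by (intro sum_mono mult_left_mono weighted_mean_square_le u v)
  also have "\<dots> = (\<Sum>i\<in>I. u i * (\<Sum>j\<in>J. v j * (F i j - m i)\<^sup>2))"
    unfolding sum_distrib_left by (subst sum.swap) (simp add: mult.left_commute)
  also have "\<dots> = (\<Sum>i\<in>I. u i * ((\<Sum>j\<in>J. v j * (F i j)\<^sup>2) - (\<Sum>j\<in>J. v j * F i j)\<^sup>2))"
    unfolding m_def by (simp add: weighted_variance_eq[OF v(1)])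
  finally show ?thesis .
qed

text \<open>Tensorisation of the variance over two independent blocks, except that the second block
  counts only where the first satisfies \<open>c\<close>. Restricting to this event of probability
  \<open>s\<close> costs the factor \<open>2 / s\<close>.\<close>

lemma two_block_variance:
  fixes w c :: "'a \<Rightarrow> real" and v :: "'b \<Rightarrow> real" and F :: "'a \<Rightarrow> 'b \<Rightarrow> real"
  assumes w: "sum w I = 1" "\<And>i. i \<in> I \<Longrightarrow> 0 \<le> w i"
    and v: "sum v J = 1" "\<And>j. j \<in> J \<Longrightarrow> 0 \<le> v j"
    and c: "\<And>i. i \<in> I \<Longrightarrow> c i = 0 \<or> c i = 1"
    and s: "(\<Sum>i\<in>I. w i * c i) = s" "0 < s"
  shows "(\<Sum>i\<in>I. w i * (\<Sum>j\<in>J. v j * (F i j)\<^sup>2)) - (\<Sum>i\<in>I. w i * (\<Sum>j\<in>J. v j * F i j))\<^sup>2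
    \<le> 2 / s * ((\<Sum>j\<in>J. v j * ((\<Sum>i\<in>I. w i * (F i j)\<^sup>2) - (\<Sum>i\<in>I. w i * F i j)\<^sup>2))
              + (\<Sum>i\<in>I. w i * (c i * ((\<Sum>j\<in>J. v j * (F i j)\<^sup>2) - (\<Sum>j\<in>J. v j * F i j)\<^sup>2))))"
proof -
  \<comment> \<open>g is the mean over i and h the mean conditioned on c = 1: the variance of h is controlled by
    convexity, and g - h is a covariance with c, controlled by Cauchy-Schwarz.\<close>
  define g where "g j = (\<Sum>i\<in>I. w i * F i j)" for j
  define h where "h j = (\<Sum>i\<in>I. (w i * c i / s) * F i j)" for j
  define k where "k j = g j - h j" for j
  define A where "A = (\<Sum>j\<in>J. v j * ((\<Sum>i\<in>I. w i * (F i j)\<^sup>2) - (g j)\<^sup>2))"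
  define B where "B = (\<Sum>i\<in>I. w i * (c i * ((\<Sum>j\<in>J. v j * (F i j)\<^sup>2) - (\<Sum>j\<in>J. v j * F i j)\<^sup>2)))"
  define W where "W f = (\<Sum>j\<in>J. v j * (f j)\<^sup>2) - (\<Sum>j\<in>J. v j * f j)\<^sup>2" for f
  have u1: "(\<Sum>i\<in>I. w i * c i / s) = 1"
    using s by (simp add: sum_divide_distrib[symmetric])
  have u0: "0 \<le> w i * c i / s" if "i \<in> I" for i
    using that w(2)[OF that] c[OF that] s(2) by auto
  have A0: "0 \<le> A"
    unfolding A_def g_def using weighted_mean_square_le[OF w] v(2)
    by (intro sum_nonneg mult_nonneg_nonneg) auto
  have sq1: "(\<Sum>i\<in>I. w i * (\<Sum>j\<in>J. v j * (F i j)\<^sup>2)) = (\<Sum>j\<in>J. v j * (\<Sum>i\<in>I. w i * (F i j)\<^sup>2))"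
    unfolding sum_distrib_left by (subst sum.swap) (simp add: mult.left_commute)
  have sq2: "(\<Sum>i\<in>I. w i * (\<Sum>j\<in>J. v j * F i j)) = (\<Sum>j\<in>J. v j * g j)"
    unfolding g_def sum_distrib_left by (subst sum.swap) (simp add: mult.left_commute)
  \<comment> \<open>Law of total variance: \<open>A\<close> is the mean conditional variance over
    \<open>I\<close>, and \<open>W g\<close> is the variance of the conditional mean.\<close>
  have total: "(\<Sum>i\<in>I. w i * (\<Sum>j\<in>J. v j * (F i j)\<^sup>2)) - (\<Sum>i\<in>I. w i * (\<Sum>j\<in>J. v j * F i j))\<^sup>2 = A + W g"
    unfolding sq1 sq2 A_def W_def by (simp add: right_diff_distrib sum_subtractf)
  \<comment> \<open>Since \<open>g = h + k\<close>, the elementary bound of a squared sum by twice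
    the sum of squares applies to the centred functions.\<close>
  have "W g \<le> 2 * W h + 2 * W k"
  proof -
    have "W f = (\<Sum>j\<in>J. v j * (f j - (\<Sum>l\<in>J. v l * f l))\<^sup>2)" for f
      unfolding W_def by (rule weighted_variance_eq[OF v(1)])
    note eq = this
    define mh mk where "mh = (\<Sum>l\<in>J. v l * h l)" and "mk = (\<Sum>l\<in>J. v l * k l)"
    have mg: "(\<Sum>l\<in>J. v l * g l) = mh + mk"
      unfolding mh_def mk_def k_def by (simp add: right_diff_distrib sum_subtractf)
    have "W g = (\<Sum>j\<in>J. v j * ((h j - mh) + (k j - mk))\<^sup>2)"
      unfolding eq[of g] mg by (simp add: k_def algebra_simps)
    also have "\<dots> \<le> (\<Sum>j\<in>J. v j * (2 * (h j - mh)\<^sup>2 + 2 * (k j - mk)\<^sup>2))"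
    proof (intro sum_mono mult_left_mono v(2))
      fix j
      have "0 \<le> ((h j - mh) - (k j - mk))\<^sup>2" by simp
      then show "((h j - mh) + (k j - mk))\<^sup>2 \<le> 2 * (h j - mh)\<^sup>2 + 2 * (k j - mk)\<^sup>2"
        by (simp add: power2_eq_square algebra_simps)
    qed
    also have "\<dots> = 2 * W h + 2 * W k"
      unfolding eq[of h] eq[of k] mh_def[symmetric] mk_def[symmetric]
      by (simp add: distrib_left sum.distrib sum_distrib_left mult.left_commute)
    finally show ?thesis .
  qed
  moreover have "W h \<le> B / s"
  proof -
    have "W h \<le> (\<Sum>i\<in>I. (w i * c i / s) * ((\<Sum>j\<in>J. v j * (F i j)\<^sup>2) - (\<Sum>j\<in>J. v j * F i j)\<^sup>2))"
      unfolding W_def h_def by (rule weighted_variance_convex[OF u1 u0 v])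
    also have "\<dots> = B / s"
      unfolding B_def by (simp add: sum_divide_distrib mult.assoc)
    finally show ?thesis .
  qed
  moreover have "W k \<le> (1 / s - 1) * A"
  proof -
    have kj: "(k j)\<^sup>2 \<le> (1 / s - 1) * ((\<Sum>i\<in>I. w i * (F i j)\<^sup>2) - (g j)\<^sup>2)" for j
    proof -
      \<comment> \<open>The factor \<open>1 - c i / s\<close> has mean zero, so \<open>g j\<close>
        may be subtracted from \<open>F i j\<close> for free, which produces the conditional
        variance after Cauchy-Schwarz.\<close>
      have one: "(\<Sum>i\<in>I. w i * (1 - c i / s)) = 0"
        using u1 w(1) by (simp add: right_diff_distrib sum_subtractf)
      have "k j = (\<Sum>i\<in>I. w i * (1 - c i / s) * F i j)"
        unfolding k_def g_def h_def by (simp add: sum_subtractf[symmetric] algebra_simps)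
      also have "\<dots> = (\<Sum>i\<in>I. w i * (1 - c i / s) * F i j) - (\<Sum>i\<in>I. w i * (1 - c i / s)) * g j"
        by (simp add: one)
      also have "\<dots> = (\<Sum>i\<in>I. w i * ((1 - c i / s) * (F i j - g j)))"
        unfolding sum_distrib_right sum_subtractf[symmetric]
        by (intro sum.cong refl) (simp add: algebra_simps)
      finally have "(k j)\<^sup>2 \<le> (\<Sum>i\<in>I. w i * (1 - c i / s)\<^sup>2) * (\<Sum>i\<in>I. w i * (F i j - g j)\<^sup>2)"
        using weighted_Cauchy_Schwarz[OF w(2), where I=I] by simp
      moreover have "(\<Sum>i\<in>I. w i * (1 - c i / s)\<^sup>2) = 1 / s - 1"
      proof -
        \<comment> \<open>Expanding the square uses that \<open>c\<close> takes only the values 0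
          and 1 and hence equals its own square.\<close>
        have "(\<Sum>i\<in>I. w i * (1 - c i / s)\<^sup>2) = (\<Sum>i\<in>I. w i - (2 / s - 1 / s\<^sup>2) * (w i * c i))"
          using c by (intro sum.cong refl) (fastforce simp: power2_eq_square algebra_simps)
        also have "\<dots> = 1 - (2 / s - 1 / s\<^sup>2) * s"
          using w(1) s(1) by (simp add: sum_subtractf sum_distrib_left[symmetric])
        also have "\<dots> = 1 / s - 1" using s(2) by (simp add: field_simps power2_eq_square)
        finally show ?thesis .
      qed
      ultimately show ?thesis
        unfolding g_def by (simp add: weighted_variance_eq[OF w(1)])
    qed
    have "W k \<le> (\<Sum>j\<in>J. v j * (k j)\<^sup>2)" unfolding W_def by simp
    also have "\<dots> \<le> (\<Sum>j\<in>J. v j * ((1 / s - 1) * ((\<Sum>i\<in>I. w i * (F i j)\<^sup>2) - (g j)\<^sup>2)))"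
      by (intro sum_mono mult_left_mono kj v(2))
    also have "\<dots> = (1 / s - 1) * A" unfolding A_def by (simp add: sum_distrib_left mult.left_commute)
    finally show ?thesis .
  qed
  ultimately have "A + W g \<le> A + 2 * (B / s) + 2 * ((1 / s - 1) * A)" by linarith
  \<comment> \<open>The coefficient of \<open>A\<close> is 1 + 2 (1/s - 1) = 2/s - 1, and
    \<open>A\<close> is nonnegative.\<close>
  also have "\<dots> \<le> 2 / s * (A + B)"
    using A0 by (simp add: algebra_simps add_divide_distrib)
  finally show ?thesis unfolding total unfolding A_def B_def g_def .
qed

section \<open>Averages and variances over blocks of sites\<close>

definition overwrite :: "nat set \<Rightarrow> nat set \<Rightarrow> (nat \<Rightarrow> bool) \<Rightarrow> nat \<Rightarrow> bool" where
  "overwrite S T \<sigma> = (\<lambda>y. if y \<in> S then y \<in> T else \<sigma> y)"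

definition bernoulli_weight :: "real \<Rightarrow> nat set \<Rightarrow> nat set \<Rightarrow> real" where
  "bernoulli_weight q S T = (\<Prod>y\<in>S. if y \<in> T then 1 - q else q)"

text \<open>This is the conditional expectation given the configuration off \<open>S\<close>.
  Keeping it a function on full configurations lets block means be composed.\<close>

definition block_mean :: "real \<Rightarrow> nat set \<Rightarrow> ((nat \<Rightarrow> bool) \<Rightarrow> real) \<Rightarrow> (nat \<Rightarrow> bool) \<Rightarrow> real" where
  "block_mean q S f \<sigma> = (\<Sum>T\<in>Pow S. bernoulli_weight q S T * f (overwrite S T \<sigma>))"

definition block_var :: "real \<Rightarrow> nat set \<Rightarrow> ((nat \<Rightarrow> bool) \<Rightarrow> real) \<Rightarrow> (nat \<Rightarrow> bool) \<Rightarrow> real" where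
  "block_var q S f \<sigma> = block_mean q S (\<lambda>\<eta>. (f \<eta>)\<^sup>2) \<sigma> - (block_mean q S f \<sigma>)\<^sup>2"

lemma bernoulli_weight_nonneg: "0 \<le> q \<Longrightarrow> q \<le> 1 \<Longrightarrow> 0 \<le> bernoulli_weight q S T"
  unfolding bernoulli_weight_def by (intro prod_nonneg) auto

lemma block_mean_empty [simp]: "block_mean q {} f \<sigma> = f \<sigma>"
  by (simp add: block_mean_def bernoulli_weight_def overwrite_def)

text \<open>The subsets of \<open>insert x S\<close> split according to whether they contain
  \<open>x\<close>. This is the induction step for all facts on block means and the link to
  \<open>site_mean\<close>.\<close>

lemma block_mean_insert:
  assumes "finite S" "x \<notin> S"
  shows "block_mean q (insert x S) f \<sigma> = site_mean q x (block_mean q S f) \<sigma>"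
proof -
  have inj: "inj_on (insert x) (Pow S)"
    using assms(2) by (auto simp: inj_on_def)
  have disj: "Pow S \<inter> insert x ` Pow S = {}" using assms(2) by auto
  have ov: "overwrite (insert x S) T \<sigma> = overwrite S T (\<sigma>(x := False))"
       "overwrite (insert x S) (insert x T) \<sigma> = overwrite S T (\<sigma>(x := True))" if "T \<subseteq> S" for T
    using assms(2) that by (auto simp: overwrite_def fun_eq_iff)
  have wt: "bernoulli_weight q (insert x S) T = q * bernoulli_weight q S T"
       "bernoulli_weight q (insert x S) (insert x T) = (1 - q) * bernoulli_weight q S T" if "T \<subseteq> S" for T
  proof -
    have "(\<Prod>y\<in>S. if y = x \<or> y \<in> T then 1 - q else q) = (\<Prod>y\<in>S. if y \<in> T then 1 - q else q)"
      using assms(2) by (intro prod.cong) auto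
    then show "bernoulli_weight q (insert x S) T = q * bernoulli_weight q S T"
       "bernoulli_weight q (insert x S) (insert x T) = (1 - q) * bernoulli_weight q S T"
      using assms that by (auto simp: bernoulli_weight_def)
  qed
  have "block_mean q (insert x S) f \<sigma>
      = (\<Sum>T\<in>Pow S. bernoulli_weight q (insert x S) T * f (overwrite (insert x S) T \<sigma>))
      + (\<Sum>T\<in>Pow S. bernoulli_weight q (insert x S) (insert x T) * f (overwrite (insert x S) (insert x T) \<sigma>))"
    unfolding block_mean_def Pow_insert using assms(1) disj
    by (simp add: sum.union_disjoint sum.reindex[OF inj])
  also have "\<dots> = (\<Sum>T\<in>Pow S. q * (bernoulli_weight q S T * f (overwrite S T (\<sigma>(x := False)))))
      + (\<Sum>T\<in>Pow S. (1 - q) * (bernoulli_weight q S T * f (overwrite S T (\<sigma>(x := True)))))"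
    by (intro arg_cong2[where f="(+)"] sum.cong refl) (simp_all add: ov wt)
  finally show ?thesis by (simp add: site_mean_def block_mean_def sum_distrib_left)
qed

text \<open>Fubini's theorem for the product measure, by peeling off one site at a time.\<close>

lemma block_mean_Un:
  assumes "finite S" "finite S'" "S \<inter> S' = {}"
  shows "block_mean q (S \<union> S') f \<sigma> = block_mean q S (block_mean q S' f) \<sigma>"
  using assms(1,3)
proof (induction S arbitrary: \<sigma> rule: finite_induct)
  case (insert x S)
  have "block_mean q (insert x S \<union> S') f \<sigma> = site_mean q x (block_mean q (S \<union> S') f) \<sigma>"
    using insert assms(2) by (simp add: block_mean_insert)
  also have "block_mean q (S \<union> S') f = block_mean q S (block_mean q S' f)"
    using insert by (intro ext) auto
  finally show ?case using insert by (simp add: block_mean_insert)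
qed simp

lemma block_mean_const [simp]: "finite S \<Longrightarrow> block_mean q S (\<lambda>_. k) \<sigma> = k"
  by (induction S arbitrary: \<sigma> rule: finite_induct)
     (simp_all add: block_mean_insert site_mean_def algebra_simps)

lemma sum_bernoulli_weight: "finite S \<Longrightarrow> sum (bernoulli_weight q S) (Pow S) = 1"
  using block_mean_const[of S q 1] by (simp add: block_mean_def)

lemma block_mean_singleton: "block_mean q {x} f = site_mean q x f"
  by (intro ext) (simp add: block_mean_insert site_mean_def)

lemma block_var_singleton: "block_var q {x} f = site_var q x f"
  by (intro ext) (simp add: block_var_def site_var_def block_mean_singleton)

lemma block_mean_cong:
  "(\<And>T. T \<subseteq> S \<Longrightarrow> f (overwrite S T \<sigma>) = g (overwrite S T \<sigma>)) \<Longrightarrow> block_mean q S f \<sigma> = block_mean q S g \<sigma>"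
  unfolding block_mean_def by (intro sum.cong) auto

lemma block_mean_mono:
  assumes "0 \<le> q" "q \<le> 1" "\<And>T. T \<subseteq> S \<Longrightarrow> f (overwrite S T \<sigma>) \<le> g (overwrite S T \<sigma>)"
  shows "block_mean q S f \<sigma> \<le> block_mean q S g \<sigma>"
  unfolding block_mean_def using assms
  by (intro sum_mono mult_left_mono) (auto simp: bernoulli_weight_nonneg)

lemma block_mean_nonneg:
  assumes "0 \<le> q" "q \<le> 1" "\<And>\<eta>. 0 \<le> f \<eta>"
  shows "0 \<le> block_mean q S f \<sigma>"
  unfolding block_mean_def using assms by (intro sum_nonneg) (auto simp: bernoulli_weight_nonneg)

lemma block_mean_cmult: "block_mean q S (\<lambda>\<eta>. k * f \<eta>) \<sigma> = k * block_mean q S f \<sigma>"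
  by (simp add: block_mean_def sum_distrib_left mult.left_commute)

lemma block_mean_diff:
  "block_mean q S (\<lambda>\<eta>. f \<eta> - g \<eta>) \<sigma> = block_mean q S f \<sigma> - block_mean q S g \<sigma>"
  by (simp add: block_mean_def right_diff_distrib sum_subtractf)

lemma block_mean_sum:
  "block_mean q S (\<lambda>\<eta>. \<Sum>i\<in>I. f i \<eta>) \<sigma> = (\<Sum>i\<in>I. block_mean q S (f i) \<sigma>)"
  unfolding block_mean_def sum_distrib_left by (rule sum.swap)

text \<open>A factor that does not depend on the sites of \<open>S\<close> comes out of the
  conditional expectation.\<close>

lemma block_mean_factor:
  assumes "\<And>T. T \<subseteq> S \<Longrightarrow> g (overwrite S T \<sigma>) = g \<sigma>"
  shows "block_mean q S (\<lambda>\<eta>. g \<eta> * f \<eta>) \<sigma> = g \<sigma> * block_mean q S f \<sigma>"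
  using block_mean_cong[of S "\<lambda>\<eta>. g \<eta> * f \<eta>" \<sigma> "\<lambda>\<eta>. g \<sigma> * f \<eta>"] assms
  by (simp add: block_mean_cmult)

lemma block_mean_square_le:
  assumes "0 \<le> q" "q \<le> 1" "finite S"
  shows "(block_mean q S f \<sigma>)\<^sup>2 \<le> block_mean q S (\<lambda>\<eta>. (f \<eta>)\<^sup>2) \<sigma>"
  unfolding block_mean_def
  by (intro weighted_mean_square_le) (simp_all add: assms sum_bernoulli_weight bernoulli_weight_nonneg)

lemma block_var_nonneg: "0 \<le> q \<Longrightarrow> q \<le> 1 \<Longrightarrow> finite S \<Longrightarrow> 0 \<le> block_var q S f \<sigma>"
  using block_mean_square_le[of q S f \<sigma>] by (simp add: block_var_def)

text \<open>By the law of total variance the two sides differ by the variance over \<open>S\<close>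
  of the mean over \<open>S'\<close>, which is nonnegative.\<close>

lemma block_mean_block_var_le:
  assumes "0 \<le> q" "q \<le> 1" "finite S" "finite S'" "S \<inter> S' = {}"
  shows "block_mean q S (block_var q S' f) \<sigma> \<le> block_var q (S \<union> S') f \<sigma>"
proof -
  have "block_mean q S (block_var q S' f) \<sigma>
     = block_mean q (S \<union> S') (\<lambda>\<eta>. (f \<eta>)\<^sup>2) \<sigma> - block_mean q S (\<lambda>\<eta>. (block_mean q S' f \<eta>)\<^sup>2) \<sigma>"
    unfolding block_mean_Un[OF assms(3-5)] block_var_def by (rule block_mean_diff)
  then show ?thesis
    using block_mean_square_le[OF assms(1-3), of "block_mean q S' f" \<sigma>]
    by (simp add: block_var_def[of q "S \<union> S'"] block_mean_Un[OF assms(3-5)])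
qed

lemma overwrite_commute:
  "S \<inter> S' = {} \<Longrightarrow> overwrite S T (overwrite S' T' \<sigma>) = overwrite S' T' (overwrite S T \<sigma>)"
  by (auto simp: overwrite_def fun_eq_iff)

text \<open>The abstract inequality with both index sets taken as power sets. The constraint
  \<open>c\<close> is read with \<open>S\<close> resampled and everything else, including
  \<open>S'\<close>, still at \<open>\<sigma>\<close>.\<close>

lemma block_var_two_blocks:
  assumes q: "0 \<le> q" "q \<le> 1" and S: "finite S" "finite S'" "S \<inter> S' = {}"
    and c: "\<And>\<eta>. c \<eta> = 0 \<or> c \<eta> = 1" and s: "block_mean q S c \<sigma> = s" "0 < s"
  shows "block_var q (S \<union> S') f \<sigma>
    \<le> 2 / s * (block_mean q S' (block_var q S f) \<sigma> + block_mean q S (\<lambda>\<eta>. c \<eta> * block_var q S' f \<eta>) \<sigma>)"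
proof -
  let ?w = "bernoulli_weight q S" and ?v = "bernoulli_weight q S'"
  let ?F = "\<lambda>T T'. f (overwrite S' T' (overwrite S T \<sigma>))"
  have "(\<Sum>i\<in>Pow S. ?w i * (\<Sum>j\<in>Pow S'. ?v j * (?F i j)\<^sup>2))
        - (\<Sum>i\<in>Pow S. ?w i * (\<Sum>j\<in>Pow S'. ?v j * ?F i j))\<^sup>2
    \<le> 2 / s * ((\<Sum>j\<in>Pow S'. ?v j * ((\<Sum>i\<in>Pow S. ?w i * (?F i j)\<^sup>2) - (\<Sum>i\<in>Pow S. ?w i * ?F i j)\<^sup>2))
       + (\<Sum>i\<in>Pow S. ?w i * (c (overwrite S i \<sigma>) *
             ((\<Sum>j\<in>Pow S'. ?v j * (?F i j)\<^sup>2) - (\<Sum>j\<in>Pow S'. ?v j * ?F i j)\<^sup>2))))"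
    using s c by (intro two_block_variance)
      (simp_all add: sum_bernoulli_weight S bernoulli_weight_nonneg q block_mean_def)
  then show ?thesis
    \<comment> \<open>The first term resamples \<open>S'\<close> before \<open>S\<close>; commuting
      the two updates brings it to the order used in \<open>?F\<close>.\<close>
    unfolding block_var_def block_mean_Un[OF S]
    unfolding block_mean_def overwrite_commute[OF S(3)] .
qed

section \<open>Poincare inequalities for the East process on blocks and subintervals\<close>

definition embed_block :: "nat \<Rightarrow> nat \<Rightarrow> (nat \<Rightarrow> bool) \<Rightarrow> (nat \<Rightarrow> bool) \<Rightarrow> nat \<Rightarrow> bool" where
  "embed_block x n \<sigma> \<tau> = (\<lambda>y. if y \<in> {x+1..x+n} then \<tau> (y - x) else \<sigma> y)"

text \<open>Translation invariance of the product measure: the sites \<open>x+1..x+n\<close> are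
  shifted down to \<open>1..n\<close>.\<close>

lemma block_mean_eq_east_mean:
  "block_mean q {x+1..x+n} f \<sigma> = east_mean q n (\<lambda>\<tau>. f (embed_block x n \<sigma> \<tau>))"
  unfolding block_mean_def east_mean_def
proof (rule sum.reindex_bij_witness
    [where i="\<lambda>\<tau>. {y\<in>{x+1..x+n}. \<tau> (y - x)}" and j="\<lambda>T y. y + x \<in> T"])
  fix T assume T: "T \<in> Pow {x+1..x+n}"
  then show "(\<lambda>y. y + x \<in> T) \<in> east_confs n"
    by (fastforce simp: east_confs_def)
  show "{y\<in>{x+1..x+n}. y - x + x \<in> T} = T" using T by auto
  have ov: "overwrite {x+1..x+n} T \<sigma> = embed_block x n \<sigma> (\<lambda>y. y + x \<in> T)"
    by (auto simp: overwrite_def embed_block_def fun_eq_iff)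
  have "bernoulli_weight q {x+1..x+n} T = (\<Prod>y\<in>{1+x..n+x}. if y \<in> T then 1 - q else q)"
    by (simp add: bernoulli_weight_def add.commute)
  also have "\<dots> = east_pi q n (\<lambda>y. y + x \<in> T)"
    unfolding prod.shift_bounds_cl_nat_ivl east_pi_def ..
  finally show "east_pi q n (\<lambda>y. y + x \<in> T) * f (embed_block x n \<sigma> (\<lambda>y. y + x \<in> T))
    = bernoulli_weight q {x+1..x+n} T * f (overwrite {x+1..x+n} T \<sigma>)" by (simp only: ov)
next
  fix \<tau> assume "\<tau> \<in> east_confs n"
  then show "(\<lambda>y. y + x \<in> {y\<in>{x+1..x+n}. \<tau> (y - x)}) = \<tau>"
    by (fastforce simp: east_confs_def fun_eq_iff)
qed auto

lemma east_mean_eq_block_mean: "east_mean q L f = block_mean q {1..L} f (\<lambda>_. False)"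
proof -
  have "embed_block 0 L (\<lambda>_. False) \<tau> = \<tau>" if "\<tau> \<in> east_confs L" for \<tau>
    using that by (auto simp: embed_block_def east_confs_def fun_eq_iff)
  then have "east_mean q L f = east_mean q L (\<lambda>\<tau>. f (embed_block 0 L (\<lambda>_. False) \<tau>))"
    unfolding east_mean_def by (intro sum.cong) auto
  then show ?thesis using block_mean_eq_east_mean[of q 0 L f "\<lambda>_. False"] by simp
qed

lemma east_var_eq_block_var: "east_var q L f = block_var q {1..L} f (\<lambda>_. False)"
  by (simp add: east_var_def block_var_def east_mean_eq_block_mean)

lemma east_c_nonneg: "0 \<le> east_c x \<sigma>"
  by (simp add: east_c_def)

lemma site_var_nonneg: "0 \<le> q \<Longrightarrow> q \<le> 1 \<Longrightarrow> 0 \<le> site_var q x f \<sigma>"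
  using block_var_nonneg[of q "{x}" f \<sigma>] by (simp add: block_var_singleton)

lemma east_dirichlet_nonneg: "0 \<le> q \<Longrightarrow> q \<le> 1 \<Longrightarrow> 0 \<le> east_dirichlet q L f"
  unfolding east_dirichlet_def east_mean_eq_block_mean
  by (intro sum_nonneg block_mean_nonneg mult_nonneg_nonneg east_c_nonneg site_var_nonneg)

text \<open>For positive \<open>C\<close> this is the division-free form of the bound 1/C <= gap, so
  functions of zero variance need no exception.\<close>

definition poincare :: "real \<Rightarrow> nat \<Rightarrow> real \<Rightarrow> bool" where
  "poincare q L C \<longleftrightarrow> (\<forall>f. east_var q L f \<le> C * east_dirichlet q L f)"

text \<open>A frozen vacancy at \<open>x\<close> satisfies the constraint at \<open>x+1\<close>,
  just as the constraint at site 1 holds by definition. The block to its right is therefore a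
  shifted copy of the East process on \<open>1..n\<close>.\<close>

lemma poincare_block:
  assumes "poincare q n C" and x: "x = 0 \<or> \<not> \<sigma> x"
  shows "block_var q {x+1..x+n} f \<sigma>
    \<le> C * (\<Sum>y\<in>{x+1..x+n}. block_mean q {x+1..x+n} (\<lambda>\<eta>. east_c y \<eta> * site_var q y f \<eta>) \<sigma>)"
proof -
  define e where "e = embed_block x n \<sigma>"
  have upd: "e (\<tau>(z := b)) = (e \<tau>)(z + x := b)" if "z \<in> {1..n}" for z \<tau> b
    using that by (auto simp: e_def embed_block_def fun_eq_iff)
  have c: "east_c (z + x) (e \<tau>) = east_c z \<tau>" if "z \<in> {1..n}" for z \<tau>
    using that x by (auto simp: e_def embed_block_def east_c_def)
  have sv: "site_var q (z + x) f (e \<tau>) = site_var q z (\<lambda>\<tau>. f (e \<tau>)) \<tau>" if "z \<in> {1..n}" for z \<tau>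
    using that by (simp add: site_var_def site_mean_def upd)
  have "(\<Sum>y\<in>{x+1..x+n}. block_mean q {x+1..x+n} (\<lambda>\<eta>. east_c y \<eta> * site_var q y f \<eta>) \<sigma>)
      = (\<Sum>y\<in>{1+x..n+x}. east_mean q n (\<lambda>\<tau>. east_c y (e \<tau>) * site_var q y f (e \<tau>)))"
    unfolding block_mean_eq_east_mean e_def by (simp add: add.commute)
  also have "\<dots> = east_dirichlet q n (\<lambda>\<tau>. f (e \<tau>))"
    unfolding sum.shift_bounds_cl_nat_ivl east_dirichlet_def
    by (intro sum.cong refl) (simp add: c sv)
  finally show ?thesis
    using assms(1)[unfolded poincare_def, rule_format, of "\<lambda>\<tau>. f (e \<tau>)"]
    by (simp only: block_var_def block_mean_eq_east_mean east_var_def e_def)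
qed

definition truncate_conf :: "nat \<Rightarrow> (nat \<Rightarrow> bool) \<Rightarrow> nat \<Rightarrow> bool" where
  "truncate_conf n \<sigma> = (\<lambda>y. \<sigma> y \<and> y \<in> {1..n})"

text \<open>Sites beyond \<open>n\<close> do not affect \<open>g\<close>, so averaging over them
  changes nothing.\<close>

lemma east_mean_local:
  assumes "n \<le> m" and g: "\<And>\<sigma>. g (truncate_conf n \<sigma>) = g \<sigma>"
  shows "east_mean q m g = east_mean q n g"
proof -
  have un: "{1..m} = {1..n} \<union> {n+1..m}" using assms(1) by auto
  have inv: "block_mean q {n+1..m} g \<eta> = g \<eta>" for \<eta>
  proof -
    have "g (overwrite {n+1..m} T \<eta>) = g \<eta>" for T
    proof -
      have "truncate_conf n (overwrite {n+1..m} T \<eta>) = truncate_conf n \<eta>"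
        by (auto simp: truncate_conf_def overwrite_def fun_eq_iff)
      then show ?thesis using g by metis
    qed
    then show ?thesis
      using block_mean_cong[of "{n+1..m}" g \<eta> "\<lambda>_. g \<eta>" q] by simp
  qed
  have "block_mean q {n+1..m} g = g" using inv by (rule ext)
  then show ?thesis
    unfolding east_mean_eq_block_mean un by (subst block_mean_Un) auto
qed

text \<open>Constraints look only to the left. A function of the first \<open>n\<close> sites thus
  has the same variance and Dirichlet form on the longer interval, where the additional sites
  contribute zero site variance.\<close>

lemma poincare_antimono:
  assumes "n \<le> m" "poincare q m C"
  shows "poincare q n C"
  unfolding poincare_def
proof
  fix f :: "(nat \<Rightarrow> bool) \<Rightarrow> real"
  \<comment> \<open>The test function may depend on coordinates outside \<open>1..n\<close>;
    truncation removes this without changing it on \<open>east_confs n\<close>.\<close>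
  define f' where "f' \<sigma> = f (truncate_conf n \<sigma>)" for \<sigma>
  have tt: "truncate_conf n (truncate_conf n \<sigma>) = truncate_conf n \<sigma>" for \<sigma>
    by (auto simp: truncate_conf_def)
  have upd: "truncate_conf n ((truncate_conf n \<sigma>)(y := b)) = truncate_conf n (\<sigma>(y := b))" for \<sigma> y b
    by (auto simp: truncate_conf_def fun_eq_iff)
  have conf: "f' \<sigma> = f \<sigma>" if "\<sigma> \<in> east_confs n" for \<sigma>
  proof -
    have "truncate_conf n \<sigma> = \<sigma>" using that by (auto simp: truncate_conf_def east_confs_def fun_eq_iff)
    then show ?thesis by (simp add: f'_def)
  qed
  have var: "east_var q m f' = east_var q n f"
  proof -
    have "east_mean q m (\<lambda>\<sigma>. (f' \<sigma>)\<^sup>2) = east_mean q n (\<lambda>\<sigma>. (f' \<sigma>)\<^sup>2)" "east_mean q m f' = east_mean q n f'"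
      using assms(1) by (auto intro!: east_mean_local simp: f'_def tt)
    moreover have "east_mean q n (\<lambda>\<sigma>. (f' \<sigma>)\<^sup>2) = east_mean q n (\<lambda>\<sigma>. (f \<sigma>)\<^sup>2)" "east_mean q n f' = east_mean q n f"
      unfolding east_mean_def by (auto intro!: sum.cong simp: conf)
    ultimately show ?thesis by (simp add: east_var_def)
  qed
  have "east_mean q m (\<lambda>\<sigma>. east_c y \<sigma> * site_var q y f' \<sigma>)
      = east_mean q n (\<lambda>\<sigma>. east_c y \<sigma> * site_var q y f \<sigma>)" if y: "y \<in> {1..n}" for y
  proof -
    have "east_c y (truncate_conf n \<sigma>) = east_c y \<sigma>" for \<sigma>
      using y by (auto simp: east_c_def truncate_conf_def)
    then have "east_mean q m (\<lambda>\<sigma>. east_c y \<sigma> * site_var q y f' \<sigma>)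
      = east_mean q n (\<lambda>\<sigma>. east_c y \<sigma> * site_var q y f' \<sigma>)"
      using assms(1) by (intro east_mean_local) (auto simp: site_var_def site_mean_def f'_def upd)
    also have "\<dots> = east_mean q n (\<lambda>\<sigma>. east_c y \<sigma> * site_var q y f \<sigma>)"
    proof -
      have "site_var q y f' \<sigma> = site_var q y f \<sigma>" if "\<sigma> \<in> east_confs n" for \<sigma>
      proof -
        have "\<sigma>(y := b) \<in> east_confs n" for b using that y by (auto simp: east_confs_def)
        then show ?thesis by (simp add: site_var_def site_mean_def conf)
      qed
      then show ?thesis unfolding east_mean_def by (auto intro!: sum.cong)
    qed
    finally show ?thesis .
  qed
  moreover have "east_mean q m (\<lambda>\<sigma>. east_c y \<sigma> * site_var q y f' \<sigma>) = 0" if y: "y \<in> {1..m} - {1..n}" for y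
  proof -
    have "truncate_conf n (\<sigma>(y := b)) = truncate_conf n \<sigma>" for \<sigma> b
      using y by (auto simp: truncate_conf_def fun_eq_iff)
    then have "site_var q y f' \<sigma> = 0" for \<sigma>
      by (simp add: site_var_def site_mean_def f'_def power2_eq_square algebra_simps)
    then show ?thesis by (simp add: east_mean_def)
  qed
  ultimately have "east_dirichlet q m f' = east_dirichlet q n f"
    unfolding east_dirichlet_def using assms(1)
    by (intro sum.mono_neutral_cong_right) auto
  then show "east_var q n f \<le> C * east_dirichlet q n f"
    using assms(2) var unfolding poincare_def by metis
qed

section \<open>The two-block recursion for the Poincare constant\<close>

lemma block_mean_all_occupied:
  assumes "finite I"
  shows "block_mean q I (\<lambda>\<eta>. if \<forall>y\<in>I. \<eta> y then 1 else 0) \<sigma> = (1 - q) ^ card I"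
proof -
  have "block_mean q I (\<lambda>\<eta>. if \<forall>y\<in>I. \<eta> y then 1 else 0) \<sigma>
      = (\<Sum>T\<in>Pow I. if T = I then (1 - q) ^ card I else 0)"
    unfolding block_mean_def overwrite_def bernoulli_weight_def by (intro sum.cong refl) auto
  then show ?thesis using assms by simp
qed

text \<open>The length \<open>L - a + l - 1\<close> is the largest possible \<open>L - x\<close> for
  a vacancy \<open>x\<close> among the last \<open>l\<close> sites of the left part, namely at
  \<open>x = a - l + 1\<close>. Each of the two block terms costs \<open>C\<close> times the full
  Dirichlet form, and the two-block inequality doubles their sum and divides it by the probability
  of the good event.\<close>

lemma poincare_two_blocks:
  assumes q: "0 < q" "q < 1" and C: "poincare q a C" "poincare q (L - a + l - 1) C" "0 \<le> C"
    and l: "1 \<le> l" "l \<le> a" "a \<le> L"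
  shows "poincare q L (4 * C / (1 - (1 - q) ^ l))"
  unfolding poincare_def
proof
  fix f :: "(nat \<Rightarrow> bool) \<Rightarrow> real"
  have q': "0 \<le> q" "q \<le> 1" using q by auto
  define Z :: "nat \<Rightarrow> bool" where "Z = (\<lambda>_. False)"
  define I where "I = {a-l+1..a}"
  define s where "s = 1 - (1 - q) ^ l"
  define c :: "(nat \<Rightarrow> bool) \<Rightarrow> real" where "c \<eta> = (if \<forall>y\<in>I. \<eta> y then 0 else 1)" for \<eta>
  define lz :: "nat \<Rightarrow> (nat \<Rightarrow> bool) \<Rightarrow> real"
    where "lz x \<eta> = (if \<not> \<eta> x \<and> (\<forall>y\<in>{a-l+1..<x}. \<eta> y) then 1 else 0)" for x \<eta>
  define D where "D y \<eta> = east_c y \<eta> * site_var q y f \<eta>" for y \<eta>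
  define S where "S = {1..a}"
  define S' where "S' = {a+1..L}"
  have SL: "{1..L} = S \<union> S'" using l by (auto simp: S_def S'_def)
  have S: "finite S" "finite S'" "S \<inter> S' = {}" by (auto simp: S_def S'_def)
  have D0: "0 \<le> D y \<eta>" for y \<eta>
    unfolding D_def by (intro mult_nonneg_nonneg east_c_nonneg site_var_nonneg q')
  have ED: "east_dirichlet q L f = (\<Sum>y\<in>{1..L}. block_mean q {1..L} (D y) Z)"
    by (simp add: east_dirichlet_def east_mean_eq_block_mean D_def[abs_def] Z_def)
  have "(1 - q) ^ l < 1" using q l by (intro power_Suc_less_one power_less_one_iff[THEN iffD2]) auto
  then have s0: "0 < s" by (simp add: s_def)
  have c01: "c \<eta> = 0 \<or> c \<eta> = 1" for \<eta> by (simp add: c_def)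
  \<comment> \<open>The good event is the disjoint union over \<open>x\<close> in \<open>I\<close>
    of the events that \<open>x\<close> is the leftmost vacancy.\<close>
  have sum_lz: "(\<Sum>x\<in>I. lz x \<eta>) = c \<eta>" for \<eta>
  proof (cases "\<forall>y\<in>I. \<eta> y")
    case True
    then show ?thesis by (auto simp: c_def lz_def intro!: sum.neutral)
  next
    case False
    define m where "m = (LEAST y. y \<in> I \<and> \<not> \<eta> y)"
    have m: "m \<in> I \<and> \<not> \<eta> m" unfolding m_def by (rule LeastI_ex) (use False in auto)
    have m': "\<eta> y" if "y \<in> I" "y < m" for y
      using not_less_Least[of y "\<lambda>y. y \<in> I \<and> \<not> \<eta> y"] that unfolding m_def by auto
    have "lz x \<eta> = (if x = m then 1 else 0)" if "x \<in> I" for x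
    proof (cases x m rule: linorder_cases)
      case less
      then show ?thesis using m'[OF that] by (simp add: lz_def)
    next
      case equal
      then show ?thesis using m m' by (auto simp: lz_def I_def)
    next
      case greater
      then have "m \<in> {a-l+1..<x}" using m by (auto simp: I_def)
      then show ?thesis using m greater by (auto simp: lz_def)
    qed
    then have "(\<Sum>x\<in>I. lz x \<eta>) = (\<Sum>x\<in>I. if x = m then 1 else 0)" by (intro sum.cong) auto
    also have "\<dots> = 1" using m by (simp add: I_def)
    finally show ?thesis using False by (simp add: c_def)
  qed
  have s: "block_mean q S c Z = s"
  proof -
    have un: "S = {1..a-l} \<union> I" using l by (auto simp: S_def I_def)
    have "block_mean q I c = (\<lambda>\<eta>. s)"
    proof
      fix \<eta>
      have "c = (\<lambda>\<eta>. 1 - (if \<forall>y\<in>I. \<eta> y then 1 else 0))" by (auto simp: c_def fun_eq_iff)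
      then have "block_mean q I c \<eta> = 1 - (1 - q) ^ card I"
        using block_mean_diff[of q I "\<lambda>_. 1" "\<lambda>\<eta>. if \<forall>y\<in>I. \<eta> y then 1 else 0" \<eta>]
        by (simp add: block_mean_all_occupied I_def)
      also have "card I = l" using l by (simp add: I_def)
      finally show "block_mean q I c \<eta> = s" by (simp add: s_def)
    qed
    moreover have "{1..a-l} \<inter> I = {}" by (auto simp: I_def)
    ultimately show ?thesis unfolding un by (subst block_mean_Un) (auto simp: I_def)
  qed
  \<comment> \<open>The left block starts at site 1, so its Poincare inequality holds whatever the
    configuration on the right.\<close>
  have first: "block_mean q S' (block_var q S f) Z \<le> C * east_dirichlet q L f"
  proof -
    have "block_mean q S' (block_var q S f) Z \<le> block_mean q S' (\<lambda>\<eta>. C * (\<Sum>y\<in>S. block_mean q S (D y) \<eta>)) Z"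
      using poincare_block[OF C(1), of 0] q' by (intro block_mean_mono) (auto simp: S_def D_def[abs_def])
    also have "\<dots> = C * (\<Sum>y\<in>S. block_mean q {1..L} (D y) Z)"
      unfolding block_mean_cmult block_mean_sum SL Un_commute[of S]
      using S by (subst block_mean_Un) auto
    also have "\<dots> \<le> C * (\<Sum>y\<in>{1..L}. block_mean q {1..L} (D y) Z)"
      using C(3) S SL q' D0 by (intro mult_left_mono sum_mono2 block_mean_nonneg) auto
    finally show ?thesis by (simp add: ED)
  qed
  \<comment> \<open>The event that x is the leftmost vacancy of I only involves sites up to x, so it is independent
    of the block to the right of x, which then sees a vacancy at its left boundary.\<close>
  have leftmost: "block_mean q S (\<lambda>\<eta>. lz x \<eta> * block_var q S' f \<eta>) Z
      \<le> C * (\<Sum>y\<in>{1..L}. block_mean q {1..L} (\<lambda>\<eta>. lz x \<eta> * D y \<eta>) Z)" if x: "x \<in> I" for x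
  proof -
    define A where "A = {1..x}"
    define B where "B = {x+1..a}"
    \<comment> \<open>As \<open>x <= L\<close>, this is \<open>{x+1..L}\<close>, written in the form
      that \<open>poincare_block\<close> expects.\<close>
    define R where "R = {x+1..x+(L-x)}"
    have xaL: "1 \<le> x" "x \<le> a" "x \<le> L" using x l by (auto simp: I_def)
    have SAB: "S = A \<union> B" "finite A" "finite B" "A \<inter> B = {}"
      using xaL by (auto simp: S_def A_def B_def)
    have RBS: "R = B \<union> S'" "B \<inter> S' = {}" using xaL l by (auto simp: R_def B_def S'_def)
    have LAR: "{1..L} = A \<union> R" "finite R" "A \<inter> R = {}" using xaL by (auto simp: A_def R_def)
    have lz_B: "lz x (overwrite B T \<eta>) = lz x \<eta>" for T \<eta> by (auto simp: lz_def overwrite_def B_def)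
    have lz_R: "lz x (overwrite R T \<eta>) = lz x \<eta>" for T \<eta> by (auto simp: lz_def overwrite_def R_def)
    have P: "poincare q (L - x) C"
      using C(2) by (rule poincare_antimono[rotated]) (use x l in \<open>auto simp: I_def\<close>)
    have "block_mean q S (\<lambda>\<eta>. lz x \<eta> * block_var q S' f \<eta>) Z
        = block_mean q A (\<lambda>\<eta>. lz x \<eta> * block_mean q B (block_var q S' f) \<eta>) Z"
      unfolding SAB(1) block_mean_Un[OF SAB(2-4)] by (intro block_mean_cong block_mean_factor lz_B)
    also have "\<dots> \<le> block_mean q A (\<lambda>\<eta>. lz x \<eta> * (C * (\<Sum>y\<in>R. block_mean q R (D y) \<eta>))) Z"
    proof (intro block_mean_mono q')
      fix T
      define \<eta> where "\<eta> = overwrite A T Z"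
      show "lz x \<eta> * block_mean q B (block_var q S' f) \<eta> \<le> lz x \<eta> * (C * (\<Sum>y\<in>R. block_mean q R (D y) \<eta>))"
      proof (cases "\<eta> x")
        case True
        then show ?thesis by (simp add: lz_def)
      next
        case False
        \<comment> \<open>The block \<open>S'\<close> need not touch the vacancy at
          \<open>x\<close>. Averaging over the gap \<open>B\<close> allows its variance to be
          replaced by that of the whole block \<open>R\<close>, which does touch it.\<close>
        have "block_mean q B (block_var q S' f) \<eta> \<le> block_var q R f \<eta>"
          unfolding RBS(1) by (intro block_mean_block_var_le q' SAB S RBS)
        also have "\<dots> \<le> C * (\<Sum>y\<in>R. block_mean q R (D y) \<eta>)"
          unfolding R_def D_def[abs_def] using False by (intro poincare_block P) auto
        finally show ?thesis by (intro mult_left_mono) (auto simp: lz_def)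
      qed
    qed
    also have "\<dots> = C * (\<Sum>y\<in>R. block_mean q A (\<lambda>\<eta>. lz x \<eta> * block_mean q R (D y) \<eta>) Z)"
      by (simp only: mult.left_commute[of _ C] block_mean_cmult sum_distrib_left[of "lz x _"] block_mean_sum)
    also have "\<dots> = C * (\<Sum>y\<in>R. block_mean q {1..L} (\<lambda>\<eta>. lz x \<eta> * D y \<eta>) Z)"
      unfolding LAR(1) block_mean_Un[OF SAB(2) LAR(2,3)]
      by (intro arg_cong[where f="(*) C"] sum.cong refl block_mean_cong block_mean_factor[symmetric] lz_R)
    also have "\<dots> \<le> C * (\<Sum>y\<in>{1..L}. block_mean q {1..L} (\<lambda>\<eta>. lz x \<eta> * D y \<eta>) Z)"
      using C(3) SAB(2) LAR q' D0
      by (intro mult_left_mono sum_mono2 block_mean_nonneg mult_nonneg_nonneg) (auto simp: lz_def)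
    finally show ?thesis .
  qed
  have second: "block_mean q S (\<lambda>\<eta>. c \<eta> * block_var q S' f \<eta>) Z \<le> C * east_dirichlet q L f"
  proof -
    have "block_mean q S (\<lambda>\<eta>. c \<eta> * block_var q S' f \<eta>) Z
        = (\<Sum>x\<in>I. block_mean q S (\<lambda>\<eta>. lz x \<eta> * block_var q S' f \<eta>) Z)"
      by (simp add: sum_lz[symmetric] sum_distrib_right block_mean_sum)
    also have "\<dots> \<le> (\<Sum>x\<in>I. C * (\<Sum>y\<in>{1..L}. block_mean q {1..L} (\<lambda>\<eta>. lz x \<eta> * D y \<eta>) Z))"
      by (intro sum_mono leftmost)
    also have "\<dots> = C * (\<Sum>y\<in>{1..L}. \<Sum>x\<in>I. block_mean q {1..L} (\<lambda>\<eta>. lz x \<eta> * D y \<eta>) Z)"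
      unfolding sum_distrib_left[symmetric] by (subst sum.swap) (rule refl)
    \<comment> \<open>The events are disjoint, so their indicators add up to \<open>c\<close>, which
      is at most 1, and summing over \<open>x\<close> loses no factor \<open>l\<close>.\<close>
    also have "\<dots> = C * (\<Sum>y\<in>{1..L}. block_mean q {1..L} (\<lambda>\<eta>. c \<eta> * D y \<eta>) Z)"
      by (simp add: sum_lz[symmetric] sum_distrib_right block_mean_sum)
    also have "\<dots> \<le> C * (\<Sum>y\<in>{1..L}. block_mean q {1..L} (D y) Z)"
      using C(3) q' D0 by (intro mult_left_mono sum_mono block_mean_mono) (auto simp: c_def)
    finally show ?thesis by (simp add: ED)
  qed
  have "east_var q L f \<le> 2 / s * (block_mean q S' (block_var q S f) Z
          + block_mean q S (\<lambda>\<eta>. c \<eta> * block_var q S' f \<eta>) Z)"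
    unfolding east_var_eq_block_var SL Z_def[symmetric]
    by (intro block_var_two_blocks q' S c01 s s0)
  also have "\<dots> \<le> 2 / s * (C * east_dirichlet q L f + C * east_dirichlet q L f)"
    using s0 by (intro mult_left_mono add_mono first second) auto
  finally show "east_var q L f \<le> 4 * C / (1 - (1 - q) ^ l) * east_dirichlet q L f"
    by (simp add: s_def[symmetric])
qed

section \<open>The relaxation time as the optimal Poincare constant\<close>

lemma poincare_one: "poincare q 1 1"
  by (simp add: poincare_def east_dirichlet_def east_var_eq_block_var east_mean_eq_block_mean
      east_c_def block_var_singleton block_mean_singleton)
     (simp add: site_var_def site_mean_def algebra_simps)

text \<open>Adding one site at a time with \<open>l = 1\<close> gives a crude constant, whose sole
  purpose is to show that the gap is positive.\<close>

lemma poincare_exists: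
  assumes "0 < q" "q < 1" "1 \<le> L"
  shows "\<exists>C\<ge>1. poincare q L C"
  using assms(3)
proof (induction L rule: dec_induct)
  case base
  show ?case using poincare_one by blast
next
  case (step n)
  then obtain C where C: "C \<ge> 1" "poincare q n C" by blast
  \<comment> \<open>With \<open>l = 1\<close> the length demanded of the right block is 1.\<close>
  have one: "poincare q (Suc n - n + 1 - 1) C" using poincare_antimono[OF step(1) C(2)] by simp
  have "poincare q (Suc n) (4 * C / (1 - (1 - q) ^ 1))"
    using assms step(1) C one by (intro poincare_two_blocks[where a=n]) auto
  moreover have "1 \<le> 4 * C / (1 - (1 - q) ^ 1)" using assms C(1) by (simp add: field_simps)
  ultimately show ?case by blast
qed

text \<open>The occupation of site 1 has variance q (1 - q). This keeps the set of quotients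
  defining the gap nonempty.\<close>

lemma east_var_nontrivial:
  assumes "0 < q" "q < 1" "1 \<le> L"
  shows "\<exists>f. east_var q L f \<noteq> 0"
proof
  define f :: "(nat \<Rightarrow> bool) \<Rightarrow> real" where "f \<sigma> = (if \<sigma> 1 then 1 else 0)" for \<sigma>
  have "east_mean q L f = east_mean q 1 f"
    using assms by (intro east_mean_local) (auto simp: f_def truncate_conf_def)
  moreover have "(\<lambda>\<sigma>. (f \<sigma>)\<^sup>2) = f" by (auto simp: f_def)
  moreover have "east_mean q 1 f = 1 - q"
    by (simp add: east_mean_eq_block_mean block_mean_singleton site_mean_def f_def)
  ultimately show "east_var q L f \<noteq> 0"
    using assms by (simp add: east_var_def power2_eq_square)
qed

text \<open>Any Poincare constant \<open>C\<close> makes 1/C a lower bound of all quotients. One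
  exists, so the gap is positive and its inverse is a genuine value rather than the default 1/0 =
  0.\<close>

lemma Trel_least_poincare:
  assumes q: "0 < q" "q < 1" and L: "1 \<le> L"
  shows "poincare q L (Trel q L)" and "0 < Trel q L" and "poincare q L C \<Longrightarrow> Trel q L \<le> C"
proof -
  let ?Q = "{east_dirichlet q L f / east_var q L f | f. east_var q L f \<noteq> 0}"
  have v0: "0 \<le> east_var q L f" for f
    using q by (simp add: east_var_eq_block_var block_var_nonneg)
  have d0: "0 \<le> east_dirichlet q L f" for f using q by (simp add: east_dirichlet_nonneg)
  obtain g where g: "east_var q L g \<noteq> 0" using east_var_nontrivial[OF assms] by blast
  have lower: "0 < C \<and> 1 / C \<le> east_gap q L" if P: "poincare q L C" for C
  proof -
    \<comment> \<open>A test function of positive variance forces \<open>C\<close> to be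
      positive.\<close>
    have "0 < C * east_dirichlet q L g"
      using P g v0[of g] unfolding poincare_def by (metis less_eq_real_def order_less_le_trans)
    then have C: "0 < C" using d0[of g] by (simp add: zero_less_mult_iff)
    have "1 / C \<le> Inf ?Q"
    proof (rule cInf_greatest)
      show "?Q \<noteq> {}" using g by blast
      fix r assume "r \<in> ?Q"
      then obtain f where f: "east_var q L f \<noteq> 0" "r = east_dirichlet q L f / east_var q L f" by blast
      have "0 < east_var q L f" using f(1) v0[of f] by simp
      then show "1 / C \<le> r"
        using P C unfolding poincare_def f(2) by (simp add: field_simps)
    qed
    then show ?thesis using C by (simp add: east_gap_def)
  qed
  obtain C where "poincare q L C" using poincare_exists[OF assms] by blast
  then have gap: "0 < east_gap q L" using lower[of C] by (metis divide_pos_pos less_le_trans zero_less_one)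
  then show "0 < Trel q L" by (simp add: Trel_def)
  show "Trel q L \<le> C" if "poincare q L C" for C
    using conjunct1[OF lower[OF that]] conjunct2[OF lower[OF that]] gap by (simp add: Trel_def field_simps)
  show "poincare q L (Trel q L)"
    unfolding poincare_def
  proof
    fix f
    show "east_var q L f \<le> Trel q L * east_dirichlet q L f"
    proof (cases "east_var q L f = 0")
      case True
      then show ?thesis using gap d0[of f] by (simp add: Trel_def)
    next
      case False
      then have v: "0 < east_var q L f" using v0[of f] by simp
      have "bdd_below ?Q" using v0 d0 by (intro bdd_belowI[of _ 0]) auto
      then have "east_gap q L \<le> east_dirichlet q L f / east_var q L f"
        unfolding east_gap_def using False by (intro cInf_lower) auto
      then show ?thesis using v gap by (simp add: Trel_def field_simps)
    qed
  qed
qed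

lemma Trel_mono:
  assumes "0 < q" "q < 1" "1 \<le> n" "n \<le> m"
  shows "Trel q n \<le> Trel q m"
proof -
  have "poincare q m (Trel q m)" using assms by (intro Trel_least_poincare) auto
  then show ?thesis using assms by (intro Trel_least_poincare poincare_antimono[of n m]) auto
qed

section \<open>Iterated lengthening of the interval\<close>

text \<open>With \<open>l = a div 2\<close> the right block has length 2 (a div 2) - 1, which is
  below \<open>a\<close>, so \<open>Trel q a\<close> serves as the constant for both blocks.\<close>

lemma Trel_growth:
  assumes "0 < q" "q < 1" "2 \<le> a"
  shows "Trel q (a + a div 2) \<le> 4 / (1 - (1 - q) ^ (a div 2)) * Trel q a"
proof -
  have T: "poincare q a (Trel q a)" "0 < Trel q a" using assms by (auto intro: Trel_least_poincare)
  have P: "poincare q (a + a div 2 - a + a div 2 - 1) (Trel q a)"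
    using _ T(1) by (rule poincare_antimono) simp
  have "poincare q (a + a div 2) (4 * Trel q a / (1 - (1 - q) ^ (a div 2)))"
    using assms T P by (intro poincare_two_blocks[where a=a]) auto
  then have "Trel q (a + a div 2) \<le> 4 * Trel q a / (1 - (1 - q) ^ (a div 2))"
    using assms by (intro Trel_least_poincare) auto
  then show ?thesis by simp
qed

primrec growth :: "nat \<Rightarrow> nat \<Rightarrow> nat" where
  "growth a 0 = a"
| "growth a (Suc k) = growth a k + growth a k div 2"

lemma growth_ge:
  assumes "2 \<le> a"
  shows "a \<le> growth a k" and "(4 / 3) ^ k * real a \<le> real (growth a k)"
proof -
  show ge: "a \<le> growth a k" for k by (induction k) auto
  show "(4 / 3) ^ k * real a \<le> real (growth a k)"
  proof (induction k)
    case (Suc k)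
    \<comment> \<open>Rounding down costs part of the factor 3/2: for n >= 2 one has n div 2 >= n/3,
      with equality at n = 3.\<close>
    have "4 * growth a k \<le> 3 * (growth a k + growth a k div 2)"
      using ge[of k] assms by presburger
    then have "4 * real (growth a k) \<le> 3 * real (growth a k + growth a k div 2)" by linarith
    then show ?case using Suc by simp
  qed simp
qed

text \<open>The number \<open>r\<close> bounds from below the mean number of vacancies in the last
  \<open>a div 2\<close> sites. Lengths only grow along the iteration, so the bound persists and
  every step costs at most the same factor.\<close>

lemma Trel_growth_iterated:
  assumes q: "0 < q" "q < 1" and a: "2 \<le> a" and r: "0 < r" "r \<le> q * real (a div 2)"
  shows "Trel q (growth a k) \<le> (4 / (1 - exp (- r))) ^ k * Trel q a"
proof (induction k)
  case (Suc k)
  let ?b = "growth a k" and ?K = "4 / (1 - exp (- r))"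
  have b: "2 \<le> ?b" "a div 2 \<le> ?b div 2" using growth_ge(1)[OF a, of k] a by (auto intro: div_le_mono)
  have "(1 - q) ^ (?b div 2) \<le> exp (- q) ^ (?b div 2)"
    using q exp_ge_add_one_self[of "- q"] by (intro power_mono) auto
  also have "\<dots> = exp (- (q * real (?b div 2)))"
    by (simp add: exp_of_nat_mult[symmetric] mult.commute)
  also have "\<dots> \<le> exp (- r)"
  proof -
    have "q * real (a div 2) \<le> q * real (?b div 2)" using b q by (intro mult_left_mono) auto
    then show ?thesis using r by simp
  qed
  finally have le: "(1 - q) ^ (?b div 2) \<le> exp (- r)" .
  moreover have e1: "exp (- r) < 1" using r by simp
  ultimately have "4 / (1 - (1 - q) ^ (?b div 2)) \<le> ?K"
    using order_le_less_trans[OF le e1] by (intro divide_left_mono mult_pos_pos) auto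
  moreover have T: "0 < Trel q ?b" using Trel_least_poincare(2)[OF q, of ?b] b by auto
  ultimately have "4 / (1 - (1 - q) ^ (?b div 2)) * Trel q ?b \<le> ?K * Trel q ?b"
    by (intro mult_right_mono) auto
  then have "Trel q (growth a (Suc k)) \<le> ?K * Trel q ?b"
    using Trel_growth[OF q b(1)] by simp
  also have "\<dots> \<le> ?K * (?K ^ k * Trel q a)"
    using Suc r by (intro mult_left_mono) auto
  finally show ?case by (simp add: mult.assoc)
qed simp

section \<open>Comparison of lengths of order 1/q as q tends to 0\<close>

text \<open>The number of growth steps and the cost of each depend only on \<open>d\<close> and
  \<open>d'\<close>. As \<open>d\<close> and \<open>d'\<close> come in no particular order,
  exchanging them yields the reverse bound.\<close>

lemma Trel_floor_bound:
  fixes d d' :: real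
  assumes "0 < d" "0 < d'"
  shows "\<exists>K>0. \<forall>\<^sub>F q in at_right 0. 0 < Trel q (nat \<lfloor>d / q\<rfloor>) \<and> 0 < Trel q (nat \<lfloor>d' / q\<rfloor>)
           \<and> Trel q (nat \<lfloor>d' / q\<rfloor>) \<le> K * Trel q (nat \<lfloor>d / q\<rfloor>)"
proof -
  \<comment> \<open>The factor 2 absorbs the rounding, since the floor of d/q is at least d/(2q) for
    small q.\<close>
  obtain k where k: "2 * d' / d < (4 / 3) ^ k" using real_arch_pow[of "4/3"] by auto
  define K where "K = (4 / (1 - exp (- (d / 4)))) ^ k"
  have "0 < K" using assms by (auto simp: K_def intro!: zero_less_power divide_pos_pos)
  \<comment> \<open>The bound \<open>d / 4\<close> gives d/q > 4, hence \<open>2 <= a\<close> and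
    the estimate of \<open>a div 2\<close> below; the bound \<open>d'\<close> gives
    \<open>1 <= b\<close>.\<close>
  moreover have "\<forall>\<^sub>F q in at_right 0. 0 < q \<and> q < Min {1, d / 4, d'}"
    using eventually_at_right_real[of 0 "Min {1, d / 4, d'}"] assms by simp
  then have "\<forall>\<^sub>F q in at_right 0. 0 < Trel q (nat \<lfloor>d / q\<rfloor>) \<and> 0 < Trel q (nat \<lfloor>d' / q\<rfloor>)
           \<and> Trel q (nat \<lfloor>d' / q\<rfloor>) \<le> K * Trel q (nat \<lfloor>d / q\<rfloor>)"
  proof (rule eventually_mono)
    fix q assume "0 < q \<and> q < Min {1, d / 4, d'}"
    then have q: "0 < q" "q < 1" "q < d / 4" "q < d'" by auto
    define a where "a = nat \<lfloor>d / q\<rfloor>"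
    define b where "b = nat \<lfloor>d' / q\<rfloor>"
    have dq: "4 < d / q" "1 < d' / q" using q by (simp_all add: field_simps)
    have a: "real a \<le> d / q" "d / q - 1 < real a" and b: "real b \<le> d' / q" "d' / q - 1 < real b"
      unfolding a_def b_def using dq by linarith+
    have a2: "2 \<le> a" and b1: "1 \<le> b" using a b dq by linarith+
    \<comment> \<open>This leads to a div 2 >= (d/q - 2)/2 >= d/(4q), the origin of the rate
      \<open>d / 4\<close> in \<open>K\<close>.\<close>
    have "real a - 1 \<le> 2 * real (a div 2)" by linarith
    then have "d / q \<le> 4 * real (a div 2)" using a dq by linarith
    then have r: "d / 4 \<le> q * real (a div 2)" using q by (simp add: field_simps)
    have "d / (2 * q) \<le> real a" using a dq by (simp add: field_simps)
    have "real b \<le> d' / q" by (rule b)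
    also have "\<dots> = (2 * d' / d) * (d / (2 * q))" using assms q by (simp add: field_simps)
    also have "\<dots> \<le> (4 / 3) ^ k * real a"
      using k \<open>d / (2 * q) \<le> real a\<close> q assms by (intro mult_mono) auto
    also have "\<dots> \<le> real (growth a k)" by (rule growth_ge[OF a2])
    finally have "b \<le> growth a k" by simp
    then have "Trel q b \<le> Trel q (growth a k)" using b1 q by (intro Trel_mono) auto
    also have "\<dots> \<le> K * Trel q a"
      unfolding K_def using q a2 r assms by (intro Trel_growth_iterated) auto
    finally show "0 < Trel q (nat \<lfloor>d / q\<rfloor>) \<and> 0 < Trel q (nat \<lfloor>d' / q\<rfloor>)
           \<and> Trel q (nat \<lfloor>d' / q\<rfloor>) \<le> K * Trel q (nat \<lfloor>d / q\<rfloor>)"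
      using q a2 b1 Trel_least_poincare(2)[of q a] Trel_least_poincare(2)[of q b]
      unfolding a_def b_def by auto
  qed
  ultimately show ?thesis by blast
qed

theorem mainTheorem4:
  shows "(\<forall>d d' :: real. d > 0 \<longrightarrow> d' > 0 \<longrightarrow>
            (\<lambda>q. Trel q (nat \<lfloor>d / q\<rfloor>)) \<in> \<Theta>[at_right 0](\<lambda>q. Trel q (nat \<lfloor>d' / q\<rfloor>)))
       \<and> (\<forall>d d' :: real. 0 < d \<longrightarrow> d < d' \<longrightarrow>
            ((\<lambda>q. (Trel q (nat \<lfloor>d' / q\<rfloor>) / Trel q (nat \<lfloor>d / q\<rfloor>)) powr (1 / ln (1 / q)))
               \<longlongrightarrow> 1) (at_right 0))"
proof (intro conjI allI impI)
  have bigo: "(\<lambda>q. Trel q (nat \<lfloor>d / q\<rfloor>)) \<in> O[at_right 0](\<lambda>q. Trel q (nat \<lfloor>d' / q\<rfloor>))"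
    if d: "d > 0" "d' > 0" for d d' :: real
  proof -
    obtain K where "\<forall>\<^sub>F q in at_right 0. 0 < Trel q (nat \<lfloor>d' / q\<rfloor>) \<and> 0 < Trel q (nat \<lfloor>d / q\<rfloor>)
           \<and> Trel q (nat \<lfloor>d / q\<rfloor>) \<le> K * Trel q (nat \<lfloor>d' / q\<rfloor>)"
      using Trel_floor_bound[OF d(2,1)] by blast
    then show ?thesis by (intro bigoI[of _ K]) (auto elim!: eventually_mono)
  qed
  show "(\<lambda>q. Trel q (nat \<lfloor>d / q\<rfloor>)) \<in> \<Theta>[at_right 0](\<lambda>q. Trel q (nat \<lfloor>d' / q\<rfloor>))"
    if "d > 0" "d' > 0" for d d' :: real
    using bigo[OF that] bigo[OF that(2,1)] by (simp add: bigtheta_def bigomega_iff_bigo)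
  fix d d' :: real
  assume d: "0 < d" "d < d'"
  let ?r = "\<lambda>q. Trel q (nat \<lfloor>d' / q\<rfloor>) / Trel q (nat \<lfloor>d / q\<rfloor>)"
  obtain K where K: "0 < K" "\<forall>\<^sub>F q in at_right 0. 0 < Trel q (nat \<lfloor>d / q\<rfloor>) \<and> 0 < Trel q (nat \<lfloor>d' / q\<rfloor>)
           \<and> Trel q (nat \<lfloor>d' / q\<rfloor>) \<le> K * Trel q (nat \<lfloor>d / q\<rfloor>)"
    using Trel_floor_bound[of d d'] d by auto
  obtain K' where K': "0 < K'" "\<forall>\<^sub>F q in at_right 0. 0 < Trel q (nat \<lfloor>d' / q\<rfloor>) \<and> 0 < Trel q (nat \<lfloor>d / q\<rfloor>)
           \<and> Trel q (nat \<lfloor>d / q\<rfloor>) \<le> K' * Trel q (nat \<lfloor>d' / q\<rfloor>)"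
    using Trel_floor_bound[of d' d] d by auto
  have "\<forall>\<^sub>F q::real in at_right 0. 0 < q \<and> q < 1"
    using eventually_at_right_real[of 0 "1::real"] by simp
  \<comment> \<open>Positivity of ln (1/q) is recorded because it makes the power with exponent 1/ln
    (1/q) monotone in its base.\<close>
  with K(2) K'(2) have bounds: "\<forall>\<^sub>F q in at_right 0. 1 / K' \<le> ?r q \<and> ?r q \<le> K \<and> 0 < ln (1 / q)"
  proof eventually_elim
    case (elim q)
    then show ?case using K(1) K'(1) by (auto simp: field_simps ln_div)
  qed
  \<comment> \<open>The exponent tends to 0, so a fixed positive base gives limit 1. The ratio lies
    between two such bases, and the sandwich theorem applies.\<close>
  have lim: "((\<lambda>q::real. x powr (1 / ln (1 / q))) \<longlongrightarrow> 1) (at_right 0)" if "0 < x" for x :: real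
  proof -
    have "filterlim (\<lambda>q::real. ln (1 / q)) at_top (at_right 0)"
      using filterlim_compose[OF ln_at_top filterlim_inverse_at_top_right] by (simp add: inverse_eq_divide)
    then have "((\<lambda>q::real. 1 / ln (1 / q)) \<longlongrightarrow> 0) (at_right 0)"
      using tendsto_inverse_0_at_top by (simp add: divide_inverse)
    then have "((\<lambda>q::real. x powr (1 / ln (1 / q))) \<longlongrightarrow> x powr 0) (at_right 0)"
      using that by (intro tendsto_powr tendsto_const) auto
    then show ?thesis using that by simp
  qed
  show "((\<lambda>q. ?r q powr (1 / ln (1 / q))) \<longlongrightarrow> 1) (at_right 0)"
  proof (rule tendsto_sandwich[OF _ _ lim lim])
    show "\<forall>\<^sub>F q in at_right 0. (1 / K') powr (1 / ln (1 / q)) \<le> ?r q powr (1 / ln (1 / q))"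
      using bounds by eventually_elim (use K'(1) in \<open>auto intro!: powr_mono2\<close>)
    show "\<forall>\<^sub>F q in at_right 0. ?r q powr (1 / ln (1 / q)) \<le> K powr (1 / ln (1 / q))"
      using bounds
    proof eventually_elim
      case (elim q)
      have "0 \<le> ?r q" using elim K'(1) by (smt (verit) divide_pos_pos)
      then show ?case using elim by (intro powr_mono2) auto
    qed
  qed (use K(1) K'(1) in auto)
qed

end
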